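(* Let $A$ be a nonempty subset of $\mathbb{R}$ which is both an $F_\sigma$-subset and a $G_\delta$-subset of $\mathbb{R}$. Then there exists a linear operator $\varphi^\star\colon \mathscr{B}_1(A,\mathbb{R})\to\mathscr{B}_1(\mathbb{R},\mathbb{R})$ such that: (i) $\varphi^\star$ is an extension operator, i.e. $\varphi^\star(f)(a)=f(a)$ for every $f\in\mathscr{B}_1(A,\mathbb{R})$ and every $a\in A$; (ii) $\varphi^\star$ is non-negative, i.e. $\varphi^\star(f)\ge 0$ on $\mathbb{R}$ whenever $f\in\mathscr{B}_1(A,\mathbb{R})$ and $f\ge 0$ on $A$; (iii) $\varphi^\star$ preserves unity, i.e. it maps the constant function $1$ on $A$ to the constant function $1$ on $\mathbb{R}$; (iv) the restriction of $\varphi^\star$ to $\mathscr{B}_1^b(A,\mathbb{R})$ is an isometry for the supremum norms, i.e. $\|\varphi^\star(f)\|_{\mathbb{R}}=\|f\|_A$ for every $f\in\mathscr{B}_1^b(A,\mathbb{R})$.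
   Context: For topological spaces $X,Y$, $\mathscr{B}_1(X,Y)$ denotes the set of Baire-one functions, i.e. pointwise limits of sequences of continuous functions $X\to Y$. For $A\subset\mathbb{R}$, $\mathscr{B}_1(A,\mathbb{R})$ is taken with $A$ carrying the subspace topology. $\mathscr{B}_1^b(A,\mathbb{R})$ denotes the bounded elements of $\mathscr{B}_1(A,\mathbb{R})$, and $\|f\|_A=\sup_{x\in A}|f(x)|$ (similarly $\|\cdot\|_{\mathbb{R}}$). Real-valued functions are added, scaled and ordered pointwise. *)

theory Defs
  imports "HOL-Analysis.Analysis"
begin

text \<open>A function with domain \<open>S\<close> is represented by an element of \<open>extensional S\<close>, so that two
  functions are equal as soon as they agree on \<open>S\<close>. For \<open>S = UNIV\<close> this imposes nothing.\<close>

definition baire_one :: "'a topology \<Rightarrow> 'b topology \<Rightarrow> ('a \<Rightarrow> 'b) set" where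
  "baire_one X Y = {f \<in> extensional (topspace X).
     \<exists>F :: nat \<Rightarrow> 'a \<Rightarrow> 'b. (\<forall>n. continuous_map X Y (F n)) \<and>
       (\<forall>x \<in> topspace X. limitin Y (\<lambda>n. F n x) (f x) sequentially)}"

abbreviation baire_one_real :: "real set \<Rightarrow> (real \<Rightarrow> real) set" where
  "baire_one_real A \<equiv> baire_one (top_of_set A) euclideanreal"

definition bounded_baire_one_real :: "real set \<Rightarrow> (real \<Rightarrow> real) set" where
  "bounded_baire_one_real A = {f \<in> baire_one_real A. bounded (f ` A)}"

text \<open>Meaningful only if \<open>A\<close> is nonempty and \<open>f\<close> is bounded on \<open>A\<close>, since \<open>Sup\<close> on the reals is
  unspecified otherwise.\<close>

definition sup_norm :: "'a set \<Rightarrow> ('a \<Rightarrow> real) \<Rightarrow> real" where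
  "sup_norm A f = (SUP x\<in>A. \<bar>f x\<bar>)"

text \<open>Linear operators between spaces \<open>V\<close> of functions on \<open>S\<close> and \<open>W\<close> of functions on \<open>T\<close>, with
  pointwise operations restricted to the respective domain.\<close>

definition linear_operator ::
  "'a set \<Rightarrow> ('a \<Rightarrow> real) set \<Rightarrow> 'b set \<Rightarrow> ('b \<Rightarrow> real) set \<Rightarrow> (('a \<Rightarrow> real) \<Rightarrow> 'b \<Rightarrow> real) \<Rightarrow> bool" where
  "linear_operator S V T W \<phi> \<longleftrightarrow>
     \<phi> \<in> V \<rightarrow> W \<and>
     (\<forall>f \<in> V. \<forall>g \<in> V. \<phi> (\<lambda>x\<in>S. f x + g x) = (\<lambda>x\<in>T. \<phi> f x + \<phi> g x)) \<and>
     (\<forall>c. \<forall>f \<in> V. \<phi> (\<lambda>x\<in>S. c * f x) = (\<lambda>x\<in>T. c * \<phi> f x))"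

end

theory Submission
  imports Defs
begin

text \<open>Fix \<open>a\<close> in \<open>A\<close> and extend every \<open>f\<close> by the constant value \<open>f a\<close> off \<open>A\<close>. The operator is then
  linear, non-negative and preserves unity by inspection, and since the extension takes no value
  that \<open>f\<close> does not take on \<open>A\<close>, the supremum norm is unchanged. The only point to prove is that
  the extension is again Baire-one. As \<open>A\<close> is both \<open>F\<^sub>\<sigma>\<close> and \<open>G\<^sub>\<delta>\<close>, both \<open>A\<close> and its complement are
  unions of increasing sequences of closed sets \<open>C n\<close> and \<open>K n\<close>. If continuous functions \<open>F n\<close> on \<open>A\<close>
  converge pointwise to \<open>f\<close>, then the function equal to \<open>F n\<close> on \<open>C n\<close> and to the constant \<open>f a\<close> on
  \<open>K n\<close> is continuous on the closed set \<open>C n \<union> K n\<close>, since the two pieces are closed and disjoint,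
  so it extends continuously to the whole space by Tietze's theorem. Every point eventually lies
  in \<open>C n \<union> K n\<close>, hence these extensions converge pointwise to the extension of \<open>f\<close>.\<close>

lemma baire_one_extend_constant:
  fixes A :: "'a::{metric_space,second_countable_topology} set"
    and f :: "'a \<Rightarrow> 'b::real_inner"
  assumes "fsigma_in euclidean A" and "gdelta_in euclidean A"
    and "f \<in> baire_one (top_of_set A) euclidean"
  shows "(\<lambda>x. if x \<in> A then f x else c) \<in> baire_one euclidean euclidean"
proof -
  obtain C where C: "\<And>n::nat. closed (C n)" "\<And>n. C n \<subseteq> C (Suc n)" "\<Union>(range C) = A"
    using assms(1) unfolding fsigma_in_ascending by auto
  have "fsigma_in euclidean (- A)"
    using assms(2) by (simp add: gdelta_in_fsigma_in Compl_eq_Diff_UNIV)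
  then obtain K where K: "\<And>n::nat. closed (K n)" "\<And>n. K n \<subseteq> K (Suc n)" "\<Union>(range K) = - A"
    unfolding fsigma_in_ascending by auto
  obtain F where F: "\<And>n::nat. continuous_on A (F n)"
    and lim: "\<And>x. x \<in> A \<Longrightarrow> (\<lambda>n. F n x) \<longlonglongrightarrow> f x"
    using assms(3) by (auto simp: baire_one_def)
  have "\<exists>g. continuous_on UNIV g \<and> (\<forall>x \<in> C n. g x = F n x) \<and> (\<forall>x \<in> K n. g x = c)" for n
  proof -
    have CK: "C n \<subseteq> A" "K n \<subseteq> - A"
      using C(3) K(3) by blast+
    have "continuous_on (C n \<union> K n) (\<lambda>x. if x \<in> A then F n x else c)"
    proof (rule continuous_on_cases)
      show "continuous_on (C n) (F n)"
        using F CK(1) by (rule continuous_on_subset)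
    qed (use C(1) K(1) CK in auto)
    moreover have "closedin (top_of_set UNIV) (C n \<union> K n)"
      using C(1) K(1) by auto
    ultimately obtain g where "continuous_on UNIV g"
      and "\<And>x. x \<in> C n \<union> K n \<Longrightarrow> g x = (if x \<in> A then F n x else c)"
      by (rule Tietze_unbounded) blast
    with CK show ?thesis
      by (intro exI[of _ g]) auto
  qed
  then obtain G where G: "\<And>n. continuous_on UNIV (G n)"
    and GC: "\<And>n x. x \<in> C n \<Longrightarrow> G n x = F n x" and GK: "\<And>n x. x \<in> K n \<Longrightarrow> G n x = c"
    by metis
  have "(\<lambda>n. G n x) \<longlonglongrightarrow> (if x \<in> A then f x else c)" for x
  proof (cases "x \<in> A")
    case True
    then obtain m where "x \<in> C m"
      using C(3) by blast
    then have "x \<in> C n" if "m \<le> n" for n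
      using lift_Suc_mono_le[of C, OF C(2) that] by blast
    then have "\<forall>\<^sub>F n in sequentially. F n x = G n x"
      by (intro eventually_sequentiallyI[of m]) (simp add: GC)
    then show ?thesis
      using Lim_transform_eventually[OF lim[OF True]] True by simp
  next
    case False
    then obtain m where "x \<in> K m"
      using K(3) by blast
    then have "x \<in> K n" if "m \<le> n" for n
      using lift_Suc_mono_le[of K, OF K(2) that] by blast
    then have "\<forall>\<^sub>F n in sequentially. G n x = c"
      by (intro eventually_sequentiallyI[of m]) (simp add: GK)
    then show ?thesis
      using False by (simp add: tendsto_eventually)
  qed
  with G show ?thesis
    unfolding baire_one_def by (intro CollectI conjI exI[of _ G]) simp_all
qed

theorem theorem3:
  fixes A :: "real set"
  assumes "A \<noteq> {}"
    and "fsigma_in euclideanreal A"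
    and "gdelta_in euclideanreal A"
  shows "\<exists>\<phi> :: (real \<Rightarrow> real) \<Rightarrow> (real \<Rightarrow> real).
    linear_operator A (baire_one_real A) UNIV (baire_one_real UNIV) \<phi> \<and>
    (\<forall>f \<in> baire_one_real A. \<forall>a \<in> A. \<phi> f a = f a) \<and>
    (\<forall>f \<in> baire_one_real A. (\<forall>a \<in> A. 0 \<le> f a) \<longrightarrow> (\<forall>x. 0 \<le> \<phi> f x)) \<and>
    \<phi> (\<lambda>x\<in>A. 1) = (\<lambda>x. 1) \<and>
    (\<forall>f \<in> bounded_baire_one_real A.
       \<phi> f \<in> bounded_baire_one_real UNIV \<and> sup_norm UNIV (\<phi> f) = sup_norm A f)"
proof -
  obtain a where a: "a \<in> A"
    using assms(1) by blast
  define \<phi> where "\<phi> f x = (if x \<in> A then f x else f a)" for f :: "real \<Rightarrow> real" and x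
  have baire: "\<phi> f \<in> baire_one_real UNIV" if "f \<in> baire_one_real A" for f
    using baire_one_extend_constant[OF assms(2,3) that, of "f a"]
    by (simp add: \<phi>_def[abs_def])
  have range_eq: "range (\<phi> f) = f ` A" for f
    using a by (auto simp: \<phi>_def)
  have "linear_operator A (baire_one_real A) UNIV (baire_one_real UNIV) \<phi>"
    unfolding linear_operator_def using a baire by (auto simp: \<phi>_def fun_eq_iff)
  moreover have "\<phi> f \<in> bounded_baire_one_real UNIV \<and> sup_norm UNIV (\<phi> f) = sup_norm A f"
    if "f \<in> bounded_baire_one_real A" for f
  proof -
    have "range (\<lambda>x. \<bar>\<phi> f x\<bar>) = (\<lambda>x. \<bar>f x\<bar>) ` A"
      using arg_cong[OF range_eq[of f], of "image abs"] by (simp add: image_image)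
    then show ?thesis
      using that baire by (simp add: bounded_baire_one_real_def sup_norm_def range_eq)
  qed
  ultimately show ?thesis
    using a by (intro exI[of _ \<phi>]) (auto simp: \<phi>_def)
qed

end
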